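(* Let $\mathbb{K}$ be a field of characteristic zero and let $p,q$ be integers with $\min(p,q)\ge 2$ and $\max(p,q)\ge 3$. Then $$\operatorname{Lie}(x^p,y^q)\cap\mathbb{K}[x]=x^p\,\mathbb{K}[x^{pq-p-q}]\qquad\text{and}\qquad \operatorname{Lie}(x^p,y^q)\cap\mathbb{K}[y]=y^q\,\mathbb{K}[y^{pq-p-q}].$$
   Context: The polynomial algebra $\mathbb{K}[x,y]$ is regarded as a Lie algebra over $\mathbb{K}$ with the standard Poisson bracket $\{f,h\}=\frac{\partial f}{\partial x}\frac{\partial h}{\partial y}-\frac{\partial f}{\partial y}\frac{\partial h}{\partial x}$. For $f,g\in\mathbb{K}[x,y]$, $\operatorname{Lie}(f,g)$ denotes the Lie subalgebra of $(\mathbb{K}[x,y],\{\cdot,\cdot\})$ generated by $f$ and $g$. Here $x^p\,\mathbb{K}[x^{d}]$ denotes the set of all products $x^p h(x^d)$ with $h$ a one-variable polynomial over $\mathbb{K}$, and similarly for $y$. *)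

theory Defs
  imports "HOL-Computational_Algebra.Polynomial"
begin

text \<open>
  The algebra $K[x,y]$ is rendered as the type of polynomials in $y$ whose coefficients
  are polynomials in $x$, i.e. as $K[x][y]$.
\<close>

definition var_x :: "'a::comm_ring_1 poly poly" where
  "var_x = [:[:0, 1:]:]"

definition var_y :: "'a::comm_ring_1 poly poly" where
  "var_y = [:0, 1:]"

definition bscale :: "'a::comm_ring_1 \<Rightarrow> 'a poly poly \<Rightarrow> 'a poly poly" where
  "bscale c f = smult [:c:] f"

text \<open>The inner variable is $x$, so $\partial/\partial x$ acts on the coefficients.\<close>

definition deriv_x :: "'a::field poly poly \<Rightarrow> 'a poly poly" where
  "deriv_x f = map_poly pderiv f"

definition deriv_y :: "'a::field poly poly \<Rightarrow> 'a poly poly" where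
  "deriv_y f = pderiv f"

definition poisson :: "'a::field poly poly \<Rightarrow> 'a poly poly \<Rightarrow> 'a poly poly" where
  "poisson f h = deriv_x f * deriv_y h - deriv_y f * deriv_x h"

definition lie_subalgebra :: "'a::field poly poly set \<Rightarrow> bool" where
  "lie_subalgebra S \<longleftrightarrow>
     module.subspace bscale S \<and> (\<forall>f\<in>S. \<forall>h\<in>S. poisson f h \<in> S)"

definition Lie :: "'a::field poly poly \<Rightarrow> 'a poly poly \<Rightarrow> 'a poly poly set" where
  "Lie f g = lie_subalgebra hull {f, g}"

text \<open>The value $h(f)$ of a one-variable polynomial $h$ over $K$ at an element $f$ of $K[x,y]$.\<close>

definition eval_at :: "'a::comm_ring_1 poly \<Rightarrow> 'a poly poly \<Rightarrow> 'a poly poly" where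
  "eval_at h f = poly (map_poly (\<lambda>c. [:[:c:]:]) h) f"

definition polys_x :: "'a::comm_ring_1 poly poly set" where
  "polys_x = range (\<lambda>h. eval_at h var_x)"

definition polys_y :: "'a::comm_ring_1 poly poly set" where
  "polys_y = range (\<lambda>h. eval_at h var_y)"

lemma vector_space_bscale: "vector_space (bscale :: 'a::field \<Rightarrow> _)"
proof
  fix a b :: 'a and f g :: "'a poly poly"
  show "bscale a (f + g) = bscale a f + bscale a g"
    by (simp add: bscale_def smult_add_right)
  show "bscale (a + b) f = bscale a f + bscale b f"
    by (simp add: bscale_def flip: smult_add_left)
  show "bscale a (bscale b f) = bscale (a * b) f"
    by (simp add: bscale_def mult.commute)
  show "bscale 1 f = f"
    by (simp add: bscale_def flip: one_pCons)
qed

lemma module_bscale: "module (bscale :: 'a::field \<Rightarrow> _)"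
  using vector_space_bscale by (simp add: module_iff_vector_space)

lemma lie_subalgebra_iff:
  "lie_subalgebra S \<longleftrightarrow>
     0 \<in> S \<and> (\<forall>f\<in>S. \<forall>h\<in>S. f + h \<in> S) \<and> (\<forall>c. \<forall>f\<in>S. bscale c f \<in> S) \<and>
     (\<forall>f\<in>S. \<forall>h\<in>S. poisson f h \<in> S)"
  by (auto simp: lie_subalgebra_def module.subspace_def[OF module_bscale])

lemma lie_subalgebra_Lie: "lie_subalgebra (Lie f g)"
  unfolding Lie_def by (rule hull_in) (auto simp: lie_subalgebra_iff)

lemma generators_in_Lie: "f \<in> Lie f g" "g \<in> Lie f g"
  using hull_subset[of "{f, g}" lie_subalgebra] by (auto simp: Lie_def)

lemma deriv_vars:
  "deriv_x (var_x :: 'a::field poly poly) = 1" "deriv_y (var_x :: 'a poly poly) = 0"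
  "deriv_x (var_y :: 'a poly poly) = 0" "deriv_y (var_y :: 'a poly poly) = 1"
  by (simp_all add: deriv_x_def deriv_y_def var_x_def var_y_def map_poly_pCons pderiv_pCons
      one_pCons)

lemma eval_at_pCons: "eval_at (pCons c h) f = [:[:c:]:] + f * eval_at h f"
  by (simp add: eval_at_def map_poly_pCons)

lemma eval_at_var_x: "eval_at h var_x = [:h:]"
  by (induction h) (simp_all add: eval_at_pCons var_x_def, simp_all add: eval_at_def)

lemma eval_at_var_y: "eval_at h var_y = map_poly (\<lambda>c. [:c:]) h"
  by (induction h) (simp_all add: eval_at_pCons var_y_def map_poly_pCons, simp_all add: eval_at_def)

end

theory Submission
  imports Defs
begin

text \<open>
  The bracket of two monomials is a multiple of one monomial,
  $\{x^a y^b, x^c y^d\} = (ad - bc)\, x^{a+c-1} y^{b+d-1}$. Hence a monomial arising from $i$ copies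
  of $x^p$ and $j$ copies of $y^q$ has exponents $(i(p-1) - j + 1,\; j(q-1) - i + 1)$, and
  if the second one vanishes, the first one is $p + j(pq-p-q)$. Conversely,
  $\mathrm{ad}(x^p)^{q-1}\,\mathrm{ad}(y^q)$ maps $x^a$ to a nonzero multiple of $x^{a+pq-p-q}$, so
  all these powers of $x$ are reached from $x^p$. The case of $y$ is symmetric.
\<close>

section \<open>Monomials and the powers obtained from the generators by bracketing\<close>

definition bmonom :: "nat \<Rightarrow> nat \<Rightarrow> 'a::comm_ring_1 poly poly" where
  "bmonom a b = monom (monom 1 a) b"

lemma var_x_power: "var_x ^ a = bmonom a 0"
  by (simp add: bmonom_def var_x_def monom_0 poly_const_pow monom_altdef)

lemma var_y_power: "var_y ^ b = bmonom 0 b"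
  by (simp add: bmonom_def var_y_def monom_altdef flip: one_pCons)

lemma poisson_bmonom:
  "poisson (bmonom a b) (bmonom c d) =
     bscale (of_nat a * of_nat d - of_nat b * of_nat c) (bmonom (a + c - 1) (b + d - 1))"
proof -
  have dx: "deriv_x (bmonom a b) = monom (monom (of_nat a) (a - 1)) b" for a b
    by (simp add: deriv_x_def bmonom_def map_poly_monom pderiv_monom)
  have dy: "deriv_y (bmonom a b) = monom (monom (of_nat b) a) (b - 1)" for a b
    by (simp add: deriv_y_def bmonom_def pderiv_monom of_nat_monom mult_monom)
  \<comment> \<open>The exponents on the two sides differ only where subtraction truncates. One of
    the two factors of the coefficient is then zero, so both sides vanish.\<close>
  have "monom (monom (of_nat a * of_nat d) (a - 1 + c)) (b + (d - 1)) =
      monom (monom (of_nat a * of_nat d :: 'a) (a + c - 1)) (b + d - 1)"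
    and "monom (monom (of_nat b * of_nat c) (a + (c - 1))) (b - 1 + d) =
      monom (monom (of_nat b * of_nat c :: 'a) (a + c - 1)) (b + d - 1)"
    by (cases a; cases b; cases c; cases d; simp)+
  then show ?thesis
    unfolding poisson_def dx dy by (simp add: mult_monom bscale_def bmonom_def smult_monom diff_monom)
qed

lemma bscale_cancel_mem:
  assumes "lie_subalgebra S" "bscale c f \<in> S" "c \<noteq> (0::'a::field)"
  shows "f \<in> S"
proof -
  have "bscale (inverse c) (bscale c f) \<in> S"
    using assms by (auto simp: lie_subalgebra_iff)
  then show ?thesis
    using assms(3) by (simp add: bscale_def flip: one_pCons)
qed

lemma bracket_bmonom_mem:
  assumes "lie_subalgebra S" "bmonom a b \<in> S" "bmonom c d \<in> S" "a * d \<noteq> b * c"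
  shows "(bmonom (a + c - 1) (b + d - 1) :: 'a::field_char_0 poly poly) \<in> S"
proof (rule bscale_cancel_mem[OF assms(1)])
  show "bscale (of_nat a * of_nat d - of_nat b * of_nat c) (bmonom (a + c - 1) (b + d - 1)) \<in> S"
    unfolding poisson_bmonom[symmetric] using assms by (simp add: lie_subalgebra_iff)
  \<comment> \<open>Characteristic zero: distinct natural numbers stay distinct in the
    field.\<close>
  show "of_nat a * of_nat d - of_nat b * of_nat c \<noteq> (0 :: 'a)"
    using assms(4) by (simp flip: of_nat_mult)
qed

text \<open>Each bracket with \<open>x^(s+1)\<close> lowers the y-exponent by one and raises the
  x-exponent by \<open>s\<close>. Its scalar, \<open>s + 1\<close> times the current y-exponent, is
  nonzero until that exponent reaches zero.\<close>

lemma lower_y_exponent: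
  assumes S: "lie_subalgebra S" and p: "(bmonom (Suc s) 0 :: 'a::field_char_0 poly poly) \<in> S"
  shows "(bmonom a b :: 'a poly poly) \<in> S \<Longrightarrow> (bmonom (a + b * s) 0 :: 'a poly poly) \<in> S"
proof (induction b arbitrary: a)
  case (Suc b)
  have "bmonom (a + s) b \<in> S"
    using bracket_bmonom_mem[OF S p Suc.prems] by (simp add: add.commute)
  from Suc.IH[OF this] show ?case
    by (simp add: algebra_simps)
qed simp

lemma lower_x_exponent:
  assumes S: "lie_subalgebra S" and q: "(bmonom 0 (Suc t) :: 'a::field_char_0 poly poly) \<in> S"
  shows "(bmonom a b :: 'a poly poly) \<in> S \<Longrightarrow> (bmonom 0 (b + a * t) :: 'a poly poly) \<in> S"
proof (induction a arbitrary: b)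
  case (Suc a)
  have "bmonom a (b + t) \<in> S"
    using bracket_bmonom_mem[OF S q Suc.prems] by (simp add: add.commute)
  from Suc.IH[OF this] show ?case
    by (simp add: algebra_simps)
qed simp

text \<open>With \<open>p = s + 1\<close> and \<open>q = t + 1\<close>, the hypothesis
  \<open>s * t = Suc D\<close> says D = pq - p - q without subtraction. Bracketing
  \<open>x^(s+1+k*D)\<close> with \<open>y^(t+1)\<close> gives \<open>x^(s+k*D) y^t\<close> up to a
  nonzero scalar. Removing \<open>y^t\<close> costs \<open>t\<close> brackets and adds
  \<open>s * t = D + 1\<close> to the x-exponent.\<close>

lemma pure_powers_mem:
  fixes S :: "'a::field_char_0 poly poly set"
  assumes S: "lie_subalgebra S" and p: "bmonom (Suc s) 0 \<in> S" and q: "bmonom 0 (Suc t) \<in> S"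
    and D: "s * t = Suc D"
  shows "bmonom (Suc s + k * D) 0 \<in> S" and "bmonom 0 (Suc t + k * D) \<in> S"
proof (induction k)
  case (Suc k)
  case 1
  have "bmonom (s + k * D) t \<in> S"
    using bracket_bmonom_mem[OF S Suc.IH(1) q] by simp
  from lower_y_exponent[OF S p this] show ?case
    using D by (simp add: algebra_simps)
  case 2
  have "bmonom s (t + k * D) \<in> S"
    using bracket_bmonom_mem[OF S p Suc.IH(2)] by simp
  from lower_x_exponent[OF S q this] show ?case
    using D by (simp add: algebra_simps)
qed (use p q in simp_all)

section \<open>Supports and the bidegrees of iterated brackets\<close>

definition supported_on :: "(nat \<times> nat) set \<Rightarrow> 'a::zero poly poly set" where
  "supported_on A = {f. \<forall>a b. coeff (coeff f b) a \<noteq> 0 \<longrightarrow> (a, b) \<in> A}"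

lemma supported_on_iff:
  "f \<in> supported_on A \<longleftrightarrow> (\<forall>a b. (a, b) \<notin> A \<longrightarrow> coeff (coeff f b) a = 0)"
  by (auto simp: supported_on_def)

lemma coeff_mult_nonzeroE:
  fixes f g :: "'a::comm_ring_1 poly poly"
  assumes "coeff (coeff (f * g) b) a \<noteq> 0"
  obtains a1 b1 a2 b2 where "a = a1 + a2" "b = b1 + b2"
    "coeff (coeff f b1) a1 \<noteq> 0" "coeff (coeff g b2) a2 \<noteq> 0"
proof -
  have "(\<Sum>i\<le>b. \<Sum>j\<le>a. coeff (coeff f i) j * coeff (coeff g (b - i)) (a - j)) \<noteq> 0"
    using assms by (simp add: coeff_mult coeff_sum)
  then obtain i where i: "i \<le> b"
    "(\<Sum>j\<le>a. coeff (coeff f i) j * coeff (coeff g (b - i)) (a - j)) \<noteq> 0"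
    by (metis (no_types, lifting) atMost_iff sum.neutral)
  then obtain j where j: "j \<le> a" "coeff (coeff f i) j * coeff (coeff g (b - i)) (a - j) \<noteq> 0"
    by (metis (no_types, lifting) atMost_iff sum.neutral)
  show ?thesis
    by (rule that[of j "a - j" i "b - i"]) (use i(1) j in auto)
qed

lemma coeff_deriv_x: "coeff (coeff (deriv_x f) b) a = of_nat (Suc a) * coeff (coeff f b) (Suc a)"
  by (simp add: deriv_x_def coeff_map_poly coeff_pderiv)

lemma coeff_deriv_y: "coeff (coeff (deriv_y f) b) a = of_nat (Suc b) * coeff (coeff f (Suc b)) a"
  by (simp add: deriv_y_def coeff_pderiv of_nat_poly del: of_nat_Suc)

text \<open>A term of a bracket combines one term of each argument and loses one in each exponent.
  The side conditions leave out the pairs for which this loss is impossible.\<close>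

lemma lie_subalgebra_supported_on:
  assumes A: "\<And>a b c d. (a, b) \<in> A \<Longrightarrow> (c, d) \<in> A \<Longrightarrow> a + c \<ge> 1 \<Longrightarrow> b + d \<ge> 1
      \<Longrightarrow> (a + c - 1, b + d - 1) \<in> A"
  shows "lie_subalgebra (supported_on A :: 'a::field poly poly set)"
proof -
  have prod: "deriv_x f * deriv_y h \<in> supported_on A"
    if "f \<in> supported_on A" "h \<in> supported_on A" for f h :: "'a poly poly"
    unfolding supported_on_def
  proof (intro CollectI allI impI)
    fix a b assume "coeff (coeff (deriv_x f * deriv_y h) b) a \<noteq> 0"
    then obtain a1 b1 a2 b2 where ab: "a = a1 + a2" "b = b1 + b2"
      and "coeff (coeff (deriv_x f) b1) a1 \<noteq> 0" "coeff (coeff (deriv_y h) b2) a2 \<noteq> 0"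
      by (rule coeff_mult_nonzeroE)
    then have "(Suc a1, b1) \<in> A" "(a2, Suc b2) \<in> A"
      using that by (auto simp: supported_on_def coeff_deriv_x coeff_deriv_y)
    from A[OF this] show "(a, b) \<in> A"
      by (simp add: ab)
  qed
  have add: "f + h \<in> supported_on A" "f - h \<in> supported_on A"
    if "f \<in> supported_on A" "h \<in> supported_on A" for f h :: "'a poly poly"
    using that by (simp_all add: supported_on_iff)
  have "poisson f h \<in> supported_on A"
    if "f \<in> supported_on A" "h \<in> supported_on A" for f h :: "'a poly poly"
    \<comment> \<open>The second product of the bracket is the first with \<open>f\<close> and
      \<open>h\<close> exchanged.\<close>
    using add(2)[OF prod[OF that] prod[OF that(2,1)]] by (simp add: poisson_def mult.commute)
  with add(1) show ?thesis
    by (simp add: lie_subalgebra_iff) (simp add: supported_on_iff bscale_def)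
qed

text \<open>Here \<open>i\<close> and \<open>j\<close> count the occurrences of
  \<open>x^(s+1)\<close> and \<open>y^(t+1)\<close>; the \<open>i + j - 1\<close> brackets each
  lower both exponents by one. The additive form avoids truncated subtraction.\<close>

definition bidegrees :: "nat \<Rightarrow> nat \<Rightarrow> (nat \<times> nat) set" where
  "bidegrees s t = {(a, b). \<exists>i j. a + j = i * s + 1 \<and> b + i = j * t + 1}"

text \<open>The shifted pair (a - 1, b - 1) is linear in (i, j), so the counts of the two arguments
  simply add.\<close>

lemma bidegrees_bracket:
  assumes "(a, b) \<in> bidegrees s t" "(c, d) \<in> bidegrees s t" "a + c \<ge> 1" "b + d \<ge> 1"
  shows "(a + c - 1, b + d - 1) \<in> bidegrees s t"
proof -
  from assms(1,2) obtain i j i' j'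
    where "a + j = i * s + 1" "b + i = j * t + 1" "c + j' = i' * s + 1" "d + i' = j' * t + 1"
    unfolding bidegrees_def by blast
  then have "a + c - 1 + (j + j') = (i + i') * s + 1 \<and> b + d - 1 + (i + i') = (j + j') * t + 1"
    using assms(3,4) unfolding distrib_right by linarith
  then show ?thesis
    unfolding bidegrees_def by blast
qed

text \<open>On the x-axis \<open>i = j * t + 1\<close>, so
  \<open>a + j = j * (D + 1) + s + 1\<close>. Cancelling \<open>j\<close> shows that
  \<open>k\<close> is the number of occurrences of \<open>y^(t+1)\<close>; on the y-axis it is that
  of \<open>x^(s+1)\<close>.\<close>

lemma bidegrees_axes:
  assumes D: "s * t = Suc D"
  shows "(a, 0) \<in> bidegrees s t \<Longrightarrow> \<exists>k. a = Suc s + k * D"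
    and "(0, b) \<in> bidegrees s t \<Longrightarrow> \<exists>k. b = Suc t + k * D"
proof -
  assume "(a, 0) \<in> bidegrees s t"
  then obtain j where "a + j = (j * t + 1) * s + 1"
    unfolding bidegrees_def by auto
  also have "\<dots> = j * (s * t) + s + 1"
    by (simp add: algebra_simps)
  finally show "\<exists>k. a = Suc s + k * D"
    by (auto simp: D)
next
  assume "(0, b) \<in> bidegrees s t"
  then obtain i where "b + i = (i * s + 1) * t + 1"
    unfolding bidegrees_def by auto
  also have "\<dots> = i * (s * t) + t + 1"
    by (simp add: algebra_simps)
  finally show "\<exists>k. b = Suc t + k * D"
    by (auto simp: D)
qed

lemma Lie_subset_supported_on:
  "Lie (bmonom (Suc s) 0) (bmonom 0 (Suc t)) \<subseteq>
     (supported_on (bidegrees s t) :: 'a::field poly poly set)"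
  unfolding Lie_def
proof (rule hull_minimal)
  have "(Suc s, 0) \<in> bidegrees s t" "(0, Suc t) \<in> bidegrees s t"
    unfolding bidegrees_def by (auto intro: exI[of _ 1] exI[of _ 0])
  then show "{bmonom (Suc s) 0, bmonom 0 (Suc t)} \<subseteq>
      (supported_on (bidegrees s t) :: 'a poly poly set)"
    by (auto simp: supported_on_def bmonom_def split: if_splits)
  show "lie_subalgebra (supported_on (bidegrees s t) :: 'a poly poly set)"
    by (rule lie_subalgebra_supported_on) (rule bidegrees_bracket)
qed

section \<open>Polynomials in one element with exponents in an arithmetic progression\<close>

lemma eval_at_0: "eval_at 0 f = 0"
  by (simp add: eval_at_def)

lemma eval_at_add: "eval_at (g + h) f = eval_at g f + eval_at h f"
  by (induction g h rule: poly_induct2) (simp_all add: eval_at_pCons eval_at_0 algebra_simps)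

lemma eval_at_monom: "eval_at (monom c n) f = bscale c (f ^ n)"
  by (simp add: eval_at_def bscale_def map_poly_monom poly_monom)

lemma eval_at_sum: "eval_at (\<Sum>i\<in>I. h i) f = (\<Sum>i\<in>I. eval_at (h i) f)"
  by (induction I rule: infinite_finite_induct) (simp_all add: eval_at_0 eval_at_add)

text \<open>Summing over the support alone allows reindexing along a progression.\<close>

lemma eval_at_support:
  "eval_at h f = (\<Sum>n | coeff h n \<noteq> 0. bscale (coeff h n) (f ^ n))"
proof -
  have "eval_at h f = (\<Sum>n\<le>degree h. bscale (coeff h n) (f ^ n))"
    by (subst poly_as_sum_of_monoms[of h, symmetric]) (simp add: eval_at_sum eval_at_monom)
  also have "\<dots> = (\<Sum>n | coeff h n \<noteq> 0. bscale (coeff h n) (f ^ n))"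
    by (rule sum.mono_neutral_right) (auto simp: le_degree bscale_def)
  finally show ?thesis .
qed

lemma eval_at_progression:
  assumes h: "\<And>n. coeff h n \<noteq> 0 \<Longrightarrow> \<exists>k. n = p + k * D" and D: "D > 0"
  shows "\<exists>g. eval_at h f = f ^ p * eval_at g (f ^ D)"
proof -
  define J where "J = {j. coeff h (p + j * D) \<noteq> 0}"
  have inj: "inj_on (\<lambda>j. p + j * D) J"
    using D by (auto simp: inj_on_def)
  have supp: "{n. coeff h n \<noteq> 0} = (\<lambda>j. p + j * D) ` J"
    using h by (auto simp: J_def)
  have "eval_at h f = (\<Sum>j\<in>J. bscale (coeff h (p + j * D)) (f ^ (p + j * D)))"
    by (simp add: eval_at_support supp sum.reindex[OF inj])
  also have "\<dots> = f ^ p * eval_at (\<Sum>j\<in>J. monom (coeff h (p + j * D)) j) (f ^ D)"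
    by (simp add: eval_at_sum eval_at_monom sum_distrib_left bscale_def power_add
        mult.commute[of _ D] power_mult)
  finally show ?thesis by blast
qed

text \<open>Only linearity of \<open>S\<close> matters, so this serves both for the Lie algebra and
  for the polynomials in \<open>f\<close>.\<close>

lemma progression_mem:
  fixes S :: "'a::field poly poly set"
  assumes S: "module.subspace bscale S" and pow: "\<And>k. f ^ (p + k * D) \<in> S"
  shows "f ^ p * eval_at h (f ^ D) \<in> S"
proof -
  \<comment> \<open>Generalised over \<open>k\<close>, since splitting off the constant term of
    \<open>h\<close> replaces \<open>k\<close> by \<open>k + 1\<close>.\<close>
  have "f ^ (p + k * D) * eval_at h (f ^ D) \<in> S" for k
  proof (induction h arbitrary: k)
    case 0
    show ?case
      using S by (simp add: eval_at_0 module.subspace_def[OF module_bscale])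
  next
    case (pCons c h)
    have "f ^ (p + k * D) * eval_at (pCons c h) (f ^ D) =
        bscale c (f ^ (p + k * D)) + f ^ (p + Suc k * D) * eval_at h (f ^ D)"
      by (simp add: eval_at_pCons bscale_def algebra_simps power_add)
    then show ?case
      using S pow pCons.IH[of "Suc k"] by (simp add: module.subspace_def[OF module_bscale])
  qed
  from this[of 0] show ?thesis by simp
qed

lemma subspace_range_eval_at:
  "module.subspace bscale (range (\<lambda>h. eval_at h (f :: 'a::field poly poly)))"
proof -
  have smult: "eval_at (smult c h) f = bscale c (eval_at h f)" for c h
    by (induction h) (simp_all add: eval_at_pCons eval_at_0 bscale_def smult_add_right)
  then show ?thesis
    by (auto simp: module.subspace_def[OF module_bscale] simp flip: eval_at_add smult
        intro: rev_image_eqI[of 0] simp: eval_at_0)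
qed

text \<open>Common form of the two halves of the theorem: \<open>pow\<close> gives one inclusion,
  \<open>supp\<close> the other.\<close>

lemma subalgebra_inter_range_eval_at:
  fixes f :: "'a::field poly poly"
  assumes S: "lie_subalgebra S" and D: "D > 0"
    and pow: "\<And>k. f ^ (p + k * D) \<in> S"
    and supp: "\<And>h n. eval_at h f \<in> S \<Longrightarrow> coeff h n \<noteq> 0 \<Longrightarrow> \<exists>k. n = p + k * D"
  shows "S \<inter> range (\<lambda>h. eval_at h f) = {f ^ p * eval_at h (f ^ D) | h. True}"
proof (intro equalityI subsetI)
  fix g assume "g \<in> S \<inter> range (\<lambda>h. eval_at h f)"
  then obtain h where h: "g = eval_at h f" "eval_at h f \<in> S" by auto
  have "\<exists>g. eval_at h f = f ^ p * eval_at g (f ^ D)"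
    using supp[OF h(2)] D by (rule eval_at_progression)
  then show "g \<in> {f ^ p * eval_at h (f ^ D) | h. True}"
    using h(1) by auto
next
  fix g assume "g \<in> {f ^ p * eval_at h (f ^ D) | h. True}"
  then obtain h where g: "g = f ^ p * eval_at h (f ^ D)" by blast
  have "f ^ n \<in> range (\<lambda>h. eval_at h f)" for n
    by (rule range_eqI[of _ _ "monom 1 n"]) (simp add: eval_at_monom bscale_def flip: one_pCons)
  then have "g \<in> range (\<lambda>h. eval_at h f)"
    unfolding g by (intro progression_mem subspace_range_eval_at)
  moreover have "g \<in> S"
    unfolding g using S pow by (intro progression_mem) (simp_all add: lie_subalgebra_def)
  ultimately show "g \<in> S \<inter> range (\<lambda>h. eval_at h f)"
    by blast
qed

theorem proposition7:
  fixes p q :: nat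
  assumes "min p q \<ge> 2" and "max p q \<ge> 3"
  shows "Lie (var_x ^ p) (var_y ^ q) \<inter> polys_x =
           {var_x ^ p * eval_at h (var_x ^ (p * q - p - q)) | h :: 'a::field_char_0 poly. True}
       \<and> Lie (var_x ^ p) (var_y ^ q) \<inter> polys_y =
           {var_y ^ q * eval_at h (var_y ^ (p * q - p - q)) | h :: 'a::field_char_0 poly. True}"
proof -
  obtain s t where p: "p = Suc s" and q: "q = Suc t" and "s \<ge> 1" "t \<ge> 1" "s \<ge> 2 \<or> t \<ge> 2"
    using assms by (cases p; cases q) (auto simp: max_def split: if_splits)
  define D where "D = p * q - p - q"
  \<comment> \<open>Excluding p = q = 2 makes (p - 1)(q - 1) at least 2, so \<open>D\<close> is
    positive and its definition does not truncate.\<close>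
  have "2 * 1 \<le> s * t"
    using \<open>s \<ge> 2 \<or> t \<ge> 2\<close> \<open>s \<ge> 1\<close> \<open>t \<ge> 1\<close>
    by (metis mult.commute mult_le_mono)
  then have D: "s * t = Suc D" and "D > 0"
    by (simp_all add: D_def p q)
  define L :: "'a poly poly set" where "L = Lie (var_x ^ p) (var_y ^ q)"
  have L: "lie_subalgebra L" "bmonom (Suc s) 0 \<in> L" "bmonom 0 (Suc t) \<in> L"
    using lie_subalgebra_Lie generators_in_Lie[where f = "var_x ^ p" and g = "var_y ^ q"]
    by (simp_all only: L_def p q var_x_power var_y_power)
  note pow = pure_powers_mem[OF L D]
  have sub: "L \<subseteq> supported_on (bidegrees s t)"
    unfolding L_def p q var_x_power var_y_power by (rule Lie_subset_supported_on)
  have "L \<inter> polys_x = {var_x ^ p * eval_at h (var_x ^ D) | h. True}"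
    unfolding polys_x_def
  proof (rule subalgebra_inter_range_eval_at[OF L(1) \<open>D > 0\<close>])
    show "var_x ^ (p + k * D) \<in> L" for k
      unfolding var_x_power p by (rule pow(1))
    fix h :: "'a poly" and n assume "eval_at h var_x \<in> L" "coeff h n \<noteq> 0"
    \<comment> \<open>As a polynomial in y, h(x) is the constant \<open>h\<close>, so its
      coefficient \<open>n\<close> sits at (n, 0).\<close>
    with sub have "(n, 0) \<in> bidegrees s t"
      by (force simp: eval_at_var_x supported_on_def)
    then show "\<exists>k. n = p + k * D"
      using bidegrees_axes(1)[OF D] p by simp
  qed
  moreover have "L \<inter> polys_y = {var_y ^ q * eval_at h (var_y ^ D) | h. True}"
    unfolding polys_y_def
  proof (rule subalgebra_inter_range_eval_at[OF L(1) \<open>D > 0\<close>])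
    show "var_y ^ (q + k * D) \<in> L" for k
      unfolding var_y_power q by (rule pow(2))
    fix h :: "'a poly" and n assume "eval_at h var_y \<in> L" "coeff h n \<noteq> 0"
    with sub have "(0, n) \<in> bidegrees s t"
      by (force simp: eval_at_var_y supported_on_def coeff_map_poly)
    then show "\<exists>k. n = q + k * D"
      using bidegrees_axes(2)[OF D] q by simp
  qed
  ultimately show ?thesis
    by (simp add: L_def D_def)
qed

end
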